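(* Let $F \colon \mathbb{R}^n \rightrightarrows \mathbb{R}^m$ be a set-valued mapping, let $(\bar{x}, \bar{y}) \in \mathrm{graph}\, F$, let $L$ and $M$ be nonempty subsets of the unit spheres $\mathbb{S}^{n-1} \subset \mathbb{R}^n$ and $\mathbb{S}^{m-1}\subset\mathbb{R}^m$, respectively, and let $\phi \in \Phi$. Then the following statements are equivalent: (i) $F$ is directionally $\phi$-open around $(\bar{x}, \bar{y})$ with respect to $L$ and $M$. (ii) $F$ is directionally $\phi^{-1}$-regular around $(\bar{x}, \bar{y})$ with respect to $L$ and $-M$. (iii) $F^{-1}$ is directionally $\phi^{-1}$-continuous around $(\bar{y}, \bar{x})$ with respect to $-M$ and $L$.
   Context: $\mathbb{R}^n$ carries the Euclidean norm $\|\cdot\|$; $\mathbb{B}^n(x,r)$ is the open ball of center $x$ and radius $r$; $\mathbb{S}^{n-1}$ is the unit sphere of $\mathbb{R}^n$. For a set $\Omega$, $\mathrm{cone}\,\Omega = \{t\omega : t \geq 0, \omega \in \Omega\}$ is the cone at the origin generated by $\Omega$, and $[x+\Omega] = \{x+u : u \in \Omega\}$; $-M = \{-v : v \in M\}$. For a set-valued mapping $F\colon \mathbb{R}^n \rightrightarrows \mathbb{R}^m$: $\mathrm{graph}\, F = \{(x,y) : y \in F(x)\}$, $F^{-1}(y) = \{x : y \in F(x)\}$, and $F(A) = \bigcup_{x\in A}F(x)$. $\Phi$ is the set of all strictly increasing continuous functions $\phi\colon[0,+\infty)\to[0,+\infty)$ with $\phi(0)=0$. Functions are extended by $\phi(+\infty)=+\infty$,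 and $\phi^{-1}$ denotes the inverse function of $\phi$, with value $+\infty$ at $+\infty$ and at any point outside the range of $\phi$. Directional minimal time function: for nonempty $L \subset \mathbb{S}^{n-1}$ and $\Omega \subset \mathbb{R}^n$, $T_L(x,\Omega) = \inf\{t \geq 0 : \exists u \in L,\ x+tu \in \Omega\}$, with $\inf\emptyset=+\infty$; in particular $T_L(x,\emptyset)=+\infty$. Write $T_L(x,x') = T_L(x,\{x'\})$. Definitions, for a set-valued mapping $G\colon \mathbb{R}^p\rightrightarrows\mathbb{R}^q$, $(\bar{x},\bar{y}) \in \mathrm{graph}\, G$, nonempty $L \subset \mathbb{S}^{p-1}$, $M\subset\mathbb{S}^{q-1}$, and a gauge function $\psi$ (either an element of $\Phi$ or the inverse of one): - $G$ is directionally $\psi$-open around $(\bar{x},\bar{y})$ with respect to $L$ and $M$ if there are $\epsilon>0$ and open neighborhoods $U$ of $\bar{x}$ and $V$ of $\bar{y}$ such that for every $t\in(0,\epsilon)$ and every $(x,y)\in (U\times V)\cap\mathrm{graph}\, G$, $\ \mathbb{B}^q(y,\psi(t))\cap[y+\mathrm{cone}\,M]\subset G\big(\mathbb{B}^p(x,t)\cap[x+\mathrm{cone}\,L]\big)$. - $G$ is directionally $\psi$-regular around $(\bar{x},\bar{y})$ with respect to $L$ and $M$ if there are $\epsilon>0$ and open neighborhoods $U$ of $\bar{x}$ and $V$ of $\bar{y}$ such that for every $(x,y)\in U\times V$ with $T_M(y,G(x))<\epsilon$, $\ T_L(x,G^{-1}(y))\leq\psi\big(T_M(y,G(x))\big)$.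 - $G$ is directionally $\psi$-continuous around $(\bar{x},\bar{y})$ with respect to $L$ and $M$ if there are open neighborhoods $U$ of $\bar{x}$ and $V$ of $\bar{y}$ such that for every $x,x'\in U$ and every $y\in G(x)\cap V$, $\ T_M(y,G(x'))\leq\psi\big(T_L(x',x)\big)$. *)

theory Defs
  imports "HOL-Analysis.Analysis"
begin

text \<open>Set-valued mappings are functions into sets; \<open>F(A)\<close> is written \<open>\<Union>(F ` A)\<close>
  and \<open>[x + \<Omega>]\<close> is written \<open>(+) x ` \<Omega>\<close>.\<close>

definition graph :: "('a \<Rightarrow> 'b set) \<Rightarrow> ('a \<times> 'b) set" where
  "graph F = {(x, y). y \<in> F x}"

definition inv_map :: "('a \<Rightarrow> 'b set) \<Rightarrow> 'b \<Rightarrow> 'a set" where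
  "inv_map F y = {x. y \<in> F x}"

definition gen_cone :: "'a::real_vector set \<Rightarrow> 'a set" where
  "gen_cone \<Omega> = {t *\<^sub>R \<omega> | t \<omega>. t \<ge> 0 \<and> \<omega> \<in> \<Omega>}"

lemma gen_cone_eq_cone_hull: "gen_cone \<Omega> = cone hull \<Omega>"
  by (simp add: gen_cone_def cone_hull_expl)

text \<open>Open balls with a possibly infinite radius, since a gauge may take the value \<open>\<infinity>\<close>.\<close>

definition eball :: "'a::metric_space \<Rightarrow> ennreal \<Rightarrow> 'a set" where
  "eball x r = {z. ennreal (dist x z) < r}"

lemma eball_ennreal: "eball x (ennreal r) = ball x r"
  by (auto simp: eball_def ennreal_less_iff)

text \<open>A function on \<open>[0, +\<infinity>)\<close> is represented by a function on the reals of which only the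
  values on \<open>{0..}\<close> matter.\<close>

definition gauges :: "(real \<Rightarrow> real) set" where
  "gauges = {\<phi>. \<phi> ` {0..} \<subseteq> {0..} \<and> strict_mono_on {0..} \<phi> \<and> continuous_on {0..} \<phi> \<and> \<phi> 0 = 0}"

definition gauge_ext :: "(real \<Rightarrow> real) \<Rightarrow> ennreal \<Rightarrow> ennreal" where
  "gauge_ext \<phi> t = (if t = \<infinity> then \<infinity> else ennreal (\<phi> (enn2real t)))"

text \<open>A gauge may be bounded, so its inverse may take the value \<open>\<infinity>\<close> at finite points.\<close>

definition gauge_inv :: "(real \<Rightarrow> real) \<Rightarrow> ennreal \<Rightarrow> ennreal" where
  "gauge_inv \<phi> s = (if s \<in> range (gauge_ext \<phi>) then the_inv (gauge_ext \<phi>) s else \<infinity>)"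

lemma gauge_ext_ennreal: "t \<ge> 0 \<Longrightarrow> gauge_ext \<phi> (ennreal t) = ennreal (\<phi> t)"
  by (simp add: gauge_ext_def)

lemma inj_gauge_ext:
  assumes "\<phi> \<in> gauges"
  shows "inj (gauge_ext \<phi>)"
proof (rule injI)
  fix s t assume eq: "gauge_ext \<phi> s = gauge_ext \<phi> t"
  have inj: "inj_on \<phi> {0..}" and nonneg: "\<And>r. r \<ge> 0 \<Longrightarrow> \<phi> r \<ge> 0"
    using assms by (auto simp: gauges_def intro: strict_mono_on_imp_inj_on)
  show "s = t"
    using eq nonneg inj
    by (cases s; cases t) (auto simp: gauge_ext_def dest: inj_onD)
qed

lemma gauge_inv_ennreal:
  assumes "\<phi> \<in> gauges" "t \<ge> 0"
  shows "gauge_inv \<phi> (ennreal (\<phi> t)) = ennreal t"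
  using the_inv_f_f[OF inj_gauge_ext[OF assms(1)], of "ennreal t"] assms(2)
  by (auto simp: gauge_inv_def gauge_ext_ennreal image_iff intro: exI[of _ "ennreal t"])

lemma gauge_inv_infinity:
  assumes "\<phi> \<in> gauges"
  shows "gauge_inv \<phi> \<infinity> = \<infinity>"
  using the_inv_f_f[OF inj_gauge_ext[OF assms], of "\<infinity>"]
  by (auto simp: gauge_inv_def gauge_ext_def)

lemma gauge_inv_outside:
  assumes "s \<notin> ennreal ` \<phi> ` {0..}" "s \<noteq> \<infinity>"
  shows "gauge_inv \<phi> s = \<infinity>"
proof -
  have "s \<notin> range (gauge_ext \<phi>)"
    using assms by (auto simp: gauge_ext_def image_iff)
  then show ?thesis
    by (simp add: gauge_inv_def)
qed

text \<open>In \<open>ennreal\<close> the infimum of the empty set is \<open>\<infinity>\<close>.\<close>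

definition min_time :: "'a::real_vector set \<Rightarrow> 'a \<Rightarrow> 'a set \<Rightarrow> ennreal" where
  "min_time L x \<Omega> = Inf {ennreal t | t. t \<ge> 0 \<and> (\<exists>u\<in>L. x + t *\<^sub>R u \<in> \<Omega>)}"

lemma min_time_empty: "min_time L x {} = \<infinity>"
  by (simp add: min_time_def)

definition dir_open ::
    "(ennreal \<Rightarrow> ennreal) \<Rightarrow> (real^'p \<Rightarrow> (real^'q) set) \<Rightarrow> real^'p \<Rightarrow> real^'q
      \<Rightarrow> (real^'p) set \<Rightarrow> (real^'q) set \<Rightarrow> bool" where
  "dir_open \<psi> G xbar ybar L M \<longleftrightarrow>
    (\<exists>\<epsilon>>0. \<exists>U V. open U \<and> xbar \<in> U \<and> open V \<and> ybar \<in> V \<and>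
      (\<forall>t::real. 0 < t \<and> t < \<epsilon> \<longrightarrow>
        (\<forall>(x, y) \<in> (U \<times> V) \<inter> graph G.
          eball y (\<psi> (ennreal t)) \<inter> (+) y ` gen_cone M
            \<subseteq> \<Union>(G ` (ball x t \<inter> (+) x ` gen_cone L)))))"

definition dir_regular ::
    "(ennreal \<Rightarrow> ennreal) \<Rightarrow> (real^'p \<Rightarrow> (real^'q) set) \<Rightarrow> real^'p \<Rightarrow> real^'q
      \<Rightarrow> (real^'p) set \<Rightarrow> (real^'q) set \<Rightarrow> bool" where
  "dir_regular \<psi> G xbar ybar L M \<longleftrightarrow>
    (\<exists>\<epsilon>::real. \<epsilon> > 0 \<and> (\<exists>U V. open U \<and> xbar \<in> U \<and> open V \<and> ybar \<in> V \<and>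
      (\<forall>x\<in>U. \<forall>y\<in>V. min_time M y (G x) < ennreal \<epsilon> \<longrightarrow>
        min_time L x (inv_map G y) \<le> \<psi> (min_time M y (G x)))))"

definition dir_continuous ::
    "(ennreal \<Rightarrow> ennreal) \<Rightarrow> (real^'p \<Rightarrow> (real^'q) set) \<Rightarrow> real^'p \<Rightarrow> real^'q
      \<Rightarrow> (real^'p) set \<Rightarrow> (real^'q) set \<Rightarrow> bool" where
  "dir_continuous \<psi> G xbar ybar L M \<longleftrightarrow>
    (\<exists>U V. open U \<and> xbar \<in> U \<and> open V \<and> ybar \<in> V \<and>
      (\<forall>x\<in>U. \<forall>x'\<in>U. \<forall>y \<in> G x \<inter> V.
        min_time M y (G x') \<le> \<psi> (min_time L x' {x})))"

end

theory Submission
  imports Defs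
begin

text \<open>For unit directions, \<open>T\<^sub>L(x, \<Omega>) < t\<close> says that some point of \<open>\<Omega> \<inter> [x + cone L]\<close> lies at
  distance less than \<open>t\<close> from \<open>x\<close>, and \<open>\<phi>\<^sup>-\<^sup>1(s) < t\<close> is equivalent to \<open>s < \<phi>(t)\<close>.  Hence all three
  properties unfold to the same implication: if \<open>y \<in> F(x)\<close>, \<open>y' \<in> [y + cone M]\<close> and
  \<open>\<parallel>y - y'\<parallel> < \<phi>(t)\<close>, then \<open>T\<^sub>L(x, F\<^sup>-\<^sup>1(y')) < t\<close>.  They differ only in which of \<open>t\<close>, \<open>y\<close>, \<open>y'\<close> and
  \<open>\<parallel>y - y'\<parallel>\<close> are required to be small, and shrinking the neighbourhoods turns one requirement into
  another.\<close>

section \<open>Cones and minimal times along unit directions\<close>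

lemma mem_translate_iff: "z \<in> (+) x ` A \<longleftrightarrow> z - x \<in> A" for x :: "'a::ab_group_add"
  by (force simp: image_iff algebra_simps)

lemma mem_gen_cone_uminus_iff:
  fixes v :: "'a::real_vector"
  shows "v \<in> gen_cone (uminus ` M) \<longleftrightarrow> - v \<in> gen_cone M"
proof -
  have "- v = t *\<^sub>R \<omega> \<longleftrightarrow> v = t *\<^sub>R (- \<omega>)" for t and \<omega> :: 'a
    by (auto simp: minus_equation_iff[of v])
  then show ?thesis
    unfolding gen_cone_def by blast
qed

text \<open>For a unit direction the travel time equals the distance covered. The strict inequality
  matters: the infimum need not be attained, but it lies below a bound exactly when some member of
  the set does.\<close>

lemma min_time_less_iff:
  fixes x :: "'a::real_normed_vector"
  assumes "L \<subseteq> sphere 0 1"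
  shows "min_time L x \<Omega> < ennreal t \<longleftrightarrow> (\<exists>z\<in>\<Omega>. z - x \<in> gen_cone L \<and> dist x z < t)"
proof
  assume "min_time L x \<Omega> < ennreal t"
  then obtain s u where s: "s \<ge> 0" "u \<in> L" "x + s *\<^sub>R u \<in> \<Omega>" "s < t"
    by (auto simp: min_time_def Inf_less_iff ennreal_less_iff)
  moreover have "dist x (x + s *\<^sub>R u) = s"
    using assms s by (auto simp: dist_norm)
  ultimately show "\<exists>z\<in>\<Omega>. z - x \<in> gen_cone L \<and> dist x z < t"
    by (intro bexI[of _ "x + s *\<^sub>R u"]) (auto simp: gen_cone_def)
next
  assume "\<exists>z\<in>\<Omega>. z - x \<in> gen_cone L \<and> dist x z < t"
  then obtain z s u where z: "z \<in> \<Omega>" "dist x z < t" "s \<ge> 0" "u \<in> L" "z - x = s *\<^sub>R u"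
    by (auto simp: gen_cone_def)
  moreover have "dist x z = s"
    using assms z by (auto simp: dist_norm norm_minus_commute[of x])
  moreover have "x + s *\<^sub>R u = z"
    using z(5) by (simp add: algebra_simps)
  ultimately show "min_time L x \<Omega> < ennreal t"
    unfolding min_time_def Inf_less_iff
    by (intro bexI[of _ "ennreal s"] CollectI exI[of _ s] conjI bexI[of _ u] refl)
      (simp_all add: ennreal_less_iff)
qed

section \<open>Gauges and their inverses\<close>

lemma gauge_less_iff:
  assumes "\<phi> \<in> gauges" "s \<ge> 0" "t \<ge> 0"
  shows "\<phi> s < \<phi> t \<longleftrightarrow> s < t"
  using assms strict_mono_on_less[of "{0..}" \<phi> s t] by (simp add: gauges_def)

lemma gauge_pos: "\<phi> \<in> gauges \<Longrightarrow> t > 0 \<Longrightarrow> \<phi> t > 0"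
  using gauge_less_iff[of \<phi> 0 t] by (simp add: gauges_def)

lemma gauge_nonneg: "\<phi> \<in> gauges \<Longrightarrow> t \<ge> 0 \<Longrightarrow> \<phi> t \<ge> 0"
  by (auto simp: gauges_def)

lemma gauge_small:
  assumes "\<phi> \<in> gauges" "e > 0"
  obtains d where "d > 0" "\<phi> d < e"
proof -
  from assms have "continuous_on {0..} \<phi>" "\<phi> 0 = 0"
    by (auto simp: gauges_def)
  with assms(2) obtain d where "d > 0" "\<forall>t\<in>{0..}. dist t 0 < d \<longrightarrow> dist (\<phi> t) 0 < e"
    unfolding continuous_on_iff by (metis atLeast_iff order_refl)
  \<comment> \<open>Continuity at \<open>0\<close> controls only points strictly closer than
    \<open>d\<close>, hence the half.\<close>
  then have "d / 2 > 0" "\<phi> (d / 2) < e"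
    by (auto simp: dist_real_def dest!: bspec[of _ _ "d / 2"])
  then show thesis
    by (rule that)
qed

text \<open>A finite inverse value forces \<open>s\<close> into the range of \<open>\<phi>\<close>,
  where strict monotonicity decides; conversely, the intermediate value theorem puts every
  \<open>s\<close> below \<open>\<phi> t\<close> into that range. If \<open>\<phi>\<close> is
  bounded and \<open>s\<close> is at least its supremum, both sides are false.\<close>

lemma gauge_inv_less_iff:
  assumes "\<phi> \<in> gauges" "t \<ge> 0"
  shows "gauge_inv \<phi> s < ennreal t \<longleftrightarrow> s < ennreal (\<phi> t)"
proof
  assume less: "gauge_inv \<phi> s < ennreal t"
  then have "s \<noteq> \<infinity>"
    using gauge_inv_infinity[OF assms(1)] by auto
  with less obtain a where a: "a \<ge> 0" "s = ennreal (\<phi> a)"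
    using gauge_inv_outside[of s \<phi>] by fastforce
  then show "s < ennreal (\<phi> t)"
    using less assms
    by (simp add: gauge_inv_ennreal ennreal_less_iff gauge_nonneg gauge_less_iff)
next
  assume less: "s < ennreal (\<phi> t)"
  then obtain r where r: "s = ennreal r" "r \<ge> 0" "r < \<phi> t"
    by (cases s) (auto simp: ennreal_less_iff)
  have "continuous_on {0..t} \<phi>" "\<phi> 0 = 0"
    using assms(1) by (auto simp: gauges_def intro: continuous_on_subset)
  then obtain a where a: "0 \<le> a" "\<phi> a = r"
    using IVT'[of \<phi> 0 r t] r assms(2) by auto
  then show "gauge_inv \<phi> s < ennreal t"
    using assms r gauge_inv_ennreal[OF assms(1) a(1)]
    by (auto simp: ennreal_less_iff gauge_less_iff)
qed

text \<open>Density of the order. It turns the non-strict estimates of regularity and continuity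
  into strict ones, to which the characterizations of \<open>min_time\<close> and
  \<open>gauge_inv\<close> apply.\<close>

lemma le_ennreal_iff_less:
  fixes a b :: ennreal
  shows "a \<le> b \<longleftrightarrow> (\<forall>t\<ge>0. b < ennreal t \<longrightarrow> a < ennreal t)"
proof
  assume *: "\<forall>t\<ge>0. b < ennreal t \<longrightarrow> a < ennreal t"
  show "a \<le> b"
  proof (rule ccontr)
    assume "\<not> a \<le> b"
    then obtain c where c: "b < c" "c < a"
      using dense[of b a] by (auto simp: not_le)
    then obtain t where "t \<ge> 0" "c = ennreal t"
      by (cases c) auto
    with * c show False
      by auto
  qed
qed auto

lemma le_gauge_inv_iff:
  assumes "\<phi> \<in> gauges"
  shows "a \<le> gauge_inv \<phi> s \<longleftrightarrow> (\<forall>t\<ge>0. s < ennreal (\<phi> t) \<longrightarrow> a < ennreal t)"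
  using assms by (auto simp: le_ennreal_iff_less[of a] gauge_inv_less_iff)

section \<open>Reduction of the three properties to one implication\<close>

lemma ball_graph_iff:
  "(\<forall>(x, y) \<in> (U \<times> V) \<inter> graph F. P x y) \<longleftrightarrow> (\<forall>x\<in>U. \<forall>y\<in>V. y \<in> F x \<longrightarrow> P x y)"
  by (auto simp: graph_def)

lemma mem_inv_map_iff: "x \<in> inv_map F y \<longleftrightarrow> y \<in> F x"
  by (simp add: inv_map_def)

text \<open>The points and the time are parameters because the three properties differ only in the
  ranges over which these are quantified.\<close>

definition step_bound ::
    "(real \<Rightarrow> real) \<Rightarrow> ('a::real_normed_vector \<Rightarrow> 'b::real_normed_vector set) \<Rightarrow> 'a set \<Rightarrow> 'b set
      \<Rightarrow> 'a \<Rightarrow> 'b \<Rightarrow> 'b \<Rightarrow> real \<Rightarrow> bool" where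
  "step_bound \<phi> F L M x y y' t \<longleftrightarrow>
    (y \<in> F x \<longrightarrow> y' - y \<in> gen_cone M \<longrightarrow> dist y y' < \<phi> t \<longrightarrow>
      min_time L x (inv_map F y') < ennreal t)"

text \<open>A larger time weakens the conclusion, but for increasing \<open>\<phi>\<close> it also
  admits more pairs \<open>y\<close>, \<open>y'\<close>. The second assumption supplies the premise
  already at the smaller time.\<close>

lemma step_bound_mono:
  assumes "step_bound \<phi> F L M x y y' s" "dist y y' < \<phi> s" "s \<le> t"
  shows "step_bound \<phi> F L M x y y' t"
  using assms order_less_le_trans[OF _ ennreal_leI[OF assms(3)]] by (auto simp: step_bound_def)

lemma dir_open_iff:
  assumes "L \<subseteq> sphere 0 1" "\<phi> \<in> gauges"
  shows "dir_open (gauge_ext \<phi>) F xbar ybar L M \<longleftrightarrow>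
    (\<exists>\<epsilon>>0. \<exists>U V. open U \<and> xbar \<in> U \<and> open V \<and> ybar \<in> V \<and>
      (\<forall>x\<in>U. \<forall>y\<in>V. \<forall>y' t. 0 < t \<longrightarrow> t < \<epsilon> \<longrightarrow> step_bound \<phi> F L M x y y' t))"
proof -
  have "eball y (gauge_ext \<phi> (ennreal t)) \<inter> (+) y ` gen_cone M
            \<subseteq> \<Union>(F ` (ball x t \<inter> (+) x ` gen_cone L)) \<longleftrightarrow>
    (\<forall>y'. y' - y \<in> gen_cone M \<longrightarrow> dist y y' < \<phi> t \<longrightarrow> min_time L x (inv_map F y') < ennreal t)"
    if "0 < t" for t x y
    using that assms(1)
    by (auto simp: gauge_ext_ennreal eball_ennreal min_time_less_iff mem_inv_map_iff
        mem_translate_iff subset_iff Bex_def)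
  then show ?thesis
    unfolding dir_open_def ball_graph_iff step_bound_def
    by (intro ex_cong1 conj_cong refl) (simp, blast)
qed

text \<open>Travelling from \<open>y'\<close> to \<open>y\<close> along \<open>-M\<close> is
  travelling from \<open>y\<close> to \<open>y'\<close> along \<open>M\<close>; this is where the
  sign in regularity and continuity comes from.\<close>

lemma min_time_uminus_less_iff:
  fixes y' :: "'a::real_normed_vector"
  assumes "M \<subseteq> sphere 0 1"
  shows "min_time (uminus ` M) y' \<Omega> < ennreal r \<longleftrightarrow>
    (\<exists>y\<in>\<Omega>. y' - y \<in> gen_cone M \<and> dist y y' < r)"
proof -
  have "uminus ` M \<subseteq> sphere 0 1"
    using assms by auto
  then show ?thesis
    by (simp add: min_time_less_iff mem_gen_cone_uminus_iff dist_commute)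
qed

lemma dir_regular_iff:
  assumes "M \<subseteq> sphere 0 1" "\<phi> \<in> gauges"
  shows "dir_regular (gauge_inv \<phi>) F xbar ybar L (uminus ` M) \<longleftrightarrow>
    (\<exists>\<epsilon>::real. \<epsilon> > 0 \<and> (\<exists>U V. open U \<and> xbar \<in> U \<and> open V \<and> ybar \<in> V \<and>
      (\<forall>x\<in>U. \<forall>y'\<in>V. \<forall>y t. dist y y' < \<epsilon> \<longrightarrow> t \<ge> 0 \<longrightarrow> step_bound \<phi> F L M x y y' t)))"
proof -
  have "(min_time (uminus ` M) y' (F x) < ennreal \<epsilon> \<longrightarrow>
      min_time L x (inv_map F y') \<le> gauge_inv \<phi> (min_time (uminus ` M) y' (F x))) \<longleftrightarrow>
    (\<forall>y t. dist y y' < \<epsilon> \<longrightarrow> t \<ge> 0 \<longrightarrow> step_bound \<phi> F L M x y y' t)" (is "?lhs \<longleftrightarrow> ?rhs")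
    for x y' \<epsilon>
  proof
    assume lhs: ?lhs
    show ?rhs
      unfolding step_bound_def
    proof (intro impI allI)
      fix y and t :: real
      assume t: "t \<ge> 0"
        and y: "y \<in> F x" "y' - y \<in> gen_cone M" "dist y y' < \<epsilon>" "dist y y' < \<phi> t"
      have "min_time (uminus ` M) y' (F x) < ennreal \<epsilon>"
        and "min_time (uminus ` M) y' (F x) < ennreal (\<phi> t)"
        using y by (auto simp: min_time_uminus_less_iff[OF assms(1)])
      with lhs t show "min_time L x (inv_map F y') < ennreal t"
        by (simp add: le_gauge_inv_iff[OF assms(2)])
    qed
  next
    assume R: ?rhs
    show ?lhs
      unfolding le_gauge_inv_iff[OF assms(2)] min_time_uminus_less_iff[OF assms(1)]
    proof (intro impI allI)
      fix t :: real
      assume t: "t \<ge> 0"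
        and "\<exists>y\<in>F x. y' - y \<in> gen_cone M \<and> dist y y' < \<epsilon>"
        and "\<exists>y\<in>F x. y' - y \<in> gen_cone M \<and> dist y y' < \<phi> t"
      then obtain y1 y2 where y1: "y1 \<in> F x" "y' - y1 \<in> gen_cone M" "dist y1 y' < \<epsilon>"
        and y2: "y2 \<in> F x" "y' - y2 \<in> gen_cone M" "dist y2 y' < \<phi> t"
        by (elim bexE conjE)
      \<comment> \<open>The bounds by \<open>\<epsilon>\<close> and by \<open>\<phi> t\<close> may
        have different witnesses; the one nearer to \<open>y'\<close> satisfies both.\<close>
      define y where "y = (if dist y1 y' < dist y2 y' then y1 else y2)"
      have "y \<in> F x" "y' - y \<in> gen_cone M" "dist y y' < \<epsilon>" "dist y y' < \<phi> t"
        using y1 y2 by (auto simp: y_def)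
      with R t show "min_time L x (inv_map F y') < ennreal t"
        by (simp add: step_bound_def)
    qed
  qed
  then show ?thesis
    unfolding dir_regular_def by simp
qed

text \<open>The target of the minimal time is the single point \<open>y\<close>, so no choice among
  points of \<open>F x\<close> arises. Inverting the map makes the first neighbourhood one of
  \<open>ybar\<close>.\<close>

lemma dir_continuous_inv_map_iff:
  assumes "M \<subseteq> sphere 0 1" "\<phi> \<in> gauges"
  shows "dir_continuous (gauge_inv \<phi>) (inv_map F) ybar xbar (uminus ` M) L \<longleftrightarrow>
    (\<exists>V U. open V \<and> ybar \<in> V \<and> open U \<and> xbar \<in> U \<and>
      (\<forall>x\<in>U. \<forall>y\<in>V. \<forall>y'\<in>V. \<forall>t\<ge>0. step_bound \<phi> F L M x y y' t))"
proof -
  have "(\<forall>y\<in>V. \<forall>y'\<in>V. \<forall>x \<in> inv_map F y \<inter> U.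
      min_time L x (inv_map F y') \<le> gauge_inv \<phi> (min_time (uminus ` M) y' {y})) \<longleftrightarrow>
    (\<forall>x\<in>U. \<forall>y\<in>V. \<forall>y'\<in>V. \<forall>t\<ge>0. step_bound \<phi> F L M x y y' t)" for U V
    by (auto simp: le_gauge_inv_iff[OF assms(2)] min_time_uminus_less_iff[OF assms(1)]
        mem_inv_map_iff step_bound_def)
  then show ?thesis
    unfolding dir_continuous_def by simp
qed

section \<open>Exchanging small times, small distances and small neighbourhoods\<close>

lemma dir_open_iff_dir_continuous:
  assumes L: "L \<subseteq> sphere 0 1" and M: "M \<subseteq> sphere 0 1" and \<phi>: "\<phi> \<in> gauges"
  shows "dir_open (gauge_ext \<phi>) F xbar ybar L M \<longleftrightarrow>
    dir_continuous (gauge_inv \<phi>) (inv_map F) ybar xbar (uminus ` M) L"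
proof
  assume "dir_open (gauge_ext \<phi>) F xbar ybar L M"
  then obtain \<epsilon> U V where \<epsilon>: "\<epsilon> > 0" and UV: "open U" "xbar \<in> U" "open V" "ybar \<in> V"
    and *: "\<forall>x\<in>U. \<forall>y\<in>V. \<forall>y' t. 0 < t \<longrightarrow> t < \<epsilon> \<longrightarrow> step_bound \<phi> F L M x y y' t"
    unfolding dir_open_iff[OF L \<phi>] by (elim exE conjE)
  \<comment> \<open>The hypothesis says nothing about \<open>t \<ge> \<epsilon>\<close>. With this
    radius any two points of \<open>V'\<close> are closer than
    \<open>\<phi> (\<epsilon> / 2)\<close>, so the bound at the admissible time
    \<open>\<epsilon> / 2\<close> serves all larger times.\<close>
  define V' where "V' = V \<inter> ball ybar (\<phi> (\<epsilon> / 2) / 2)"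
  have small: "\<forall>x\<in>U. \<forall>y\<in>V'. \<forall>y'\<in>V'. \<forall>t\<ge>0. step_bound \<phi> F L M x y y' t"
  proof (intro ballI allI impI)
    fix x y y' and t :: real
    assume x: "x \<in> U" and y: "y \<in> V'" "y' \<in> V'" and t: "t \<ge> 0"
    have "y \<in> V"
      using y(1) by (simp add: V'_def)
    consider "t = 0" | "0 < t" "t < \<epsilon>" | "t \<ge> \<epsilon>"
      using t by linarith
    then show "step_bound \<phi> F L M x y y' t"
    proof cases
      \<comment> \<open>Since \<open>\<phi> 0 = 0\<close>, no distance lies below
        \<open>\<phi> t\<close> and the claim is vacuous.\<close>
      case 1
      then show ?thesis
        using \<phi> by (simp add: step_bound_def gauges_def)
    next
      case 2
      with * x \<open>y \<in> V\<close> show ?thesis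
        by simp
    next
      case 3
      show ?thesis
      proof (rule step_bound_mono)
        show "step_bound \<phi> F L M x y y' (\<epsilon> / 2)"
          using * x \<open>y \<in> V\<close> \<epsilon> by simp
        show "dist y y' < \<phi> (\<epsilon> / 2)"
          by (rule dist_triangle_half_r[of ybar]) (use y in \<open>auto simp: V'_def\<close>)
        show "\<epsilon> / 2 \<le> t"
          using 3 \<epsilon> by simp
      qed
    qed
  qed
  have "open V'" "ybar \<in> V'"
    using UV gauge_pos[OF \<phi>, of "\<epsilon> / 2"] \<epsilon> by (auto simp: V'_def)
  then show "dir_continuous (gauge_inv \<phi>) (inv_map F) ybar xbar (uminus ` M) L"
    unfolding dir_continuous_inv_map_iff[OF M \<phi>]
    by (intro exI[of _ V'] exI[of _ U] conjI UV small)
next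
  assume "dir_continuous (gauge_inv \<phi>) (inv_map F) ybar xbar (uminus ` M) L"
  then obtain U V where UV: "open U" "xbar \<in> U" "open V" "ybar \<in> V"
    and *: "\<forall>x\<in>U. \<forall>y\<in>V. \<forall>y'\<in>V. \<forall>t\<ge>0. step_bound \<phi> F L M x y y' t"
    unfolding dir_continuous_inv_map_iff[OF M \<phi>] by (elim exE conjE)
  obtain d where d: "d > 0" "ball ybar d \<subseteq> V"
    using openE[OF UV(3,4)] .
  \<comment> \<open>Openness leaves \<open>y'\<close> unrestricted. For
    \<open>t < \<epsilon>\<close> the premise \<open>dist y y' < \<phi> t\<close> now keeps
    \<open>y'\<close> within \<open>d / 2\<close> of \<open>y\<close>, hence inside
    \<open>V\<close>.\<close>
  obtain \<epsilon> where \<epsilon>: "\<epsilon> > 0" "\<phi> \<epsilon> < d / 2"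
    using gauge_small[OF \<phi>, of "d / 2"] d(1) by auto
  have small: "\<forall>x\<in>U. \<forall>y\<in>ball ybar (d / 2). \<forall>y' t. 0 < t \<longrightarrow> t < \<epsilon> \<longrightarrow>
    step_bound \<phi> F L M x y y' t"
  proof (intro ballI allI impI)
    fix x y y' and t :: real
    assume x: "x \<in> U" and y: "y \<in> ball ybar (d / 2)" and t: "0 < t" "t < \<epsilon>"
    show "step_bound \<phi> F L M x y y' t"
    proof (cases "dist y y' < \<phi> t")
      case True
      have "\<phi> t < d / 2"
        using gauge_less_iff[OF \<phi>, of t \<epsilon>] t \<epsilon> by simp
      with True y have "dist ybar y' < d" "dist ybar y < d"
        using dist_triangle[of ybar y' y] d(1) by auto
      then have "y \<in> V" "y' \<in> V"
        using d(2) by auto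
      with * x t show ?thesis
        by simp
    qed (simp add: step_bound_def)
  qed
  show "dir_open (gauge_ext \<phi>) F xbar ybar L M"
    unfolding dir_open_iff[OF L \<phi>]
    by (intro exI[of _ \<epsilon>] exI[of _ U] exI[of _ "ball ybar (d / 2)"] conjI UV small \<epsilon>)
      (use d(1) in auto)
qed

text \<open>The admissible times are the same on both sides, so only the triangle inequality is at
  work: two points near \<open>ybar\<close> are near each other, and a point near some
  \<open>y'\<close> close to \<open>ybar\<close> is itself close to \<open>ybar\<close>.\<close>

lemma dir_regular_iff_dir_continuous:
  assumes M: "M \<subseteq> sphere 0 1" and \<phi>: "\<phi> \<in> gauges"
  shows "dir_regular (gauge_inv \<phi>) F xbar ybar L (uminus ` M) \<longleftrightarrow>
    dir_continuous (gauge_inv \<phi>) (inv_map F) ybar xbar (uminus ` M) L"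
proof
  assume "dir_regular (gauge_inv \<phi>) F xbar ybar L (uminus ` M)"
  then obtain \<epsilon> :: real and U V
    where \<epsilon>: "\<epsilon> > 0" and UV: "open U" "xbar \<in> U" "open V" "ybar \<in> V"
    and *: "\<forall>x\<in>U. \<forall>y'\<in>V. \<forall>y t. dist y y' < \<epsilon> \<longrightarrow> t \<ge> 0 \<longrightarrow> step_bound \<phi> F L M x y y' t"
    unfolding dir_regular_iff[OF M \<phi>] by (elim exE conjE)
  define V' where "V' = V \<inter> ball ybar (\<epsilon> / 2)"
  have small: "\<forall>x\<in>U. \<forall>y\<in>V'. \<forall>y'\<in>V'. \<forall>t\<ge>0. step_bound \<phi> F L M x y y' t"
  proof (intro ballI allI impI)
    fix x y y' and t :: real
    assume x: "x \<in> U" and y: "y \<in> V'" "y' \<in> V'" and t: "t \<ge> 0"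
    have "dist y y' < \<epsilon>"
      by (rule dist_triangle_half_r[of ybar]) (use y in \<open>auto simp: V'_def\<close>)
    moreover have "y' \<in> V"
      using y(2) by (simp add: V'_def)
    ultimately show "step_bound \<phi> F L M x y y' t"
      using * x t by simp
  qed
  have "open V'" "ybar \<in> V'"
    using UV \<epsilon> by (auto simp: V'_def)
  then show "dir_continuous (gauge_inv \<phi>) (inv_map F) ybar xbar (uminus ` M) L"
    unfolding dir_continuous_inv_map_iff[OF M \<phi>]
    by (intro exI[of _ V'] exI[of _ U] conjI UV small)
next
  assume "dir_continuous (gauge_inv \<phi>) (inv_map F) ybar xbar (uminus ` M) L"
  then obtain U V where UV: "open U" "xbar \<in> U" "open V" "ybar \<in> V"
    and *: "\<forall>x\<in>U. \<forall>y\<in>V. \<forall>y'\<in>V. \<forall>t\<ge>0. step_bound \<phi> F L M x y y' t"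
    unfolding dir_continuous_inv_map_iff[OF M \<phi>] by (elim exE conjE)
  obtain d where d: "d > 0" "ball ybar d \<subseteq> V"
    using openE[OF UV(3,4)] .
  have small: "\<forall>x\<in>U. \<forall>y'\<in>ball ybar (d / 2). \<forall>y t. dist y y' < d / 2 \<longrightarrow> t \<ge> 0 \<longrightarrow>
    step_bound \<phi> F L M x y y' t"
  proof (intro ballI allI impI)
    fix x y y' and t :: real
    assume x: "x \<in> U" and y: "y' \<in> ball ybar (d / 2)" "dist y y' < d / 2" and t: "t \<ge> 0"
    have "dist ybar y < d" "dist ybar y' < d"
      using y d(1) dist_triangle2[of ybar y y'] by auto
    then have "y \<in> V" "y' \<in> V"
      using d(2) by auto
    with * x t show "step_bound \<phi> F L M x y y' t"
      by simp
  qed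
  show "dir_regular (gauge_inv \<phi>) F xbar ybar L (uminus ` M)"
    unfolding dir_regular_iff[OF M \<phi>]
    by (intro exI[of _ "d / 2"] exI[of _ U] exI[of _ "ball ybar (d / 2)"] conjI UV small)
      (use d(1) in auto)
qed

theorem theorem3p1:
  fixes F :: "real^'n \<Rightarrow> (real^'m) set"
    and xbar :: "real^'n" and ybar :: "real^'m"
    and L :: "(real^'n) set" and M :: "(real^'m) set"
    and \<phi> :: "real \<Rightarrow> real"
  assumes "(xbar, ybar) \<in> graph F"
    and "L \<noteq> {}" and "L \<subseteq> sphere 0 1"
    and "M \<noteq> {}" and "M \<subseteq> sphere 0 1"
    and "\<phi> \<in> gauges"
  shows "(dir_open (gauge_ext \<phi>) F xbar ybar L M
            \<longleftrightarrow> dir_regular (gauge_inv \<phi>) F xbar ybar L (uminus ` M))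
       \<and> (dir_regular (gauge_inv \<phi>) F xbar ybar L (uminus ` M)
            \<longleftrightarrow> dir_continuous (gauge_inv \<phi>) (inv_map F) ybar xbar (uminus ` M) L)"
  using assms(3,5,6) by (simp add: dir_open_iff_dir_continuous dir_regular_iff_dir_continuous)

end
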